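(* Let $n \geq 1$ and let $G$ be the sibling tree $ST_n$. Then the locating-total domination number of $G$ is $$\gamma^{L}_t(G) = \begin{cases} \frac{1}{7}(2^{n+3}-1) & \text{if } n\equiv 0 \pmod 3,\\ \frac{1}{7}(2^{n+3}-2) & \text{if } n\equiv 1 \pmod 3,\\ \frac{1}{7}(2^{n+3}-4) & \text{if } n\equiv 2 \pmod 3.\end{cases}$$
   Context: The sibling tree $ST_n$ has vertex set $\{1,2,\dots,2^{n+1}-1\}$; its edges are the edges of the complete binary tree of height $n$ in which vertex $x$ has children $2x$ and $2x+1$ (root $1$ at level $0$; vertex $v$ is at level $i$ iff $2^i\le v\le 2^{i+1}-1$), together with the sibling edges $\{2x,2x+1\}$ for every $x$ with $1\le x\le 2^n-1$. A locating-total dominating set of $G$ is a set $S\subseteq V(G)$ such that every vertex of $V(G)$ is adjacent to some vertex of $S$, and for every two distinct vertices $u,v\in V(G)\setminus S$, $N(u)\cap S\neq N(v)\cap S$ (open neighborhoods). $\gamma^{L}_t(G)$ is the minimum cardinality of a locating-total dominating set. *)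

theory Defs
  imports Complex_Main
begin

text \<open>A finite simple graph is given by its vertex set \<open>V\<close> and its set \<open>E\<close> of edges, each edge
  being a two-element subset of \<open>V\<close>.\<close>

definition open_nbhd :: "'a set set \<Rightarrow> 'a \<Rightarrow> 'a set" where
  "open_nbhd E v = {u. {u, v} \<in> E}"

definition total_dominating_set :: "'a set \<Rightarrow> 'a set set \<Rightarrow> 'a set \<Rightarrow> bool" where
  "total_dominating_set V E S \<longleftrightarrow> S \<subseteq> V \<and> (\<forall>v\<in>V. \<exists>s\<in>S. {v, s} \<in> E)"

definition locating_total_dominating_set :: "'a set \<Rightarrow> 'a set set \<Rightarrow> 'a set \<Rightarrow> bool" where
  "locating_total_dominating_set V E S \<longleftrightarrow>
     total_dominating_set V E S \<and>
     (\<forall>u\<in>V - S. \<forall>v\<in>V - S. u \<noteq> v \<longrightarrow> open_nbhd E u \<inter> S \<noteq> open_nbhd E v \<inter> S)"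

definition locating_total_domination_number :: "'a set \<Rightarrow> 'a set set \<Rightarrow> nat" where
  "locating_total_domination_number V E =
     (LEAST k. \<exists>S. locating_total_dominating_set V E S \<and> finite S \<and> card S = k)"

definition sibling_tree_verts :: "nat \<Rightarrow> nat set" where
  "sibling_tree_verts n = {1..2 ^ (n + 1) - 1}"

text \<open>The internal vertices of the complete binary tree of height \<open>n\<close> are \<open>1, \<dots>, 2 ^ n - 1\<close>.\<close>

definition binary_tree_edges :: "nat \<Rightarrow> nat set set" where
  "binary_tree_edges n = (\<Union>x\<in>{1..2 ^ n - 1}. {{x, 2 * x}, {x, 2 * x + 1}})"

definition sibling_edges :: "nat \<Rightarrow> nat set set" where
  "sibling_edges n = (\<lambda>x. {2 * x, 2 * x + 1}) ` {1..2 ^ n - 1}"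

definition sibling_tree_edges :: "nat \<Rightarrow> nat set set" where
  "sibling_tree_edges n = binary_tree_edges n \<union> sibling_edges n"

end

theory Submission imports Defs begin

text \<open>In every bottom triangle \<open>{x, 2x, 2x + 1}\<close> a locating-total dominating set \<open>S\<close> has at least
  two vertices, so the two lowest levels carry at least \<open>2 ^ n\<close> vertices. Deleting the three lowest
  levels of the tree, and pushing the vertices of \<open>S\<close> on the level just below the cut up to their
  parents, leaves a locating-total dominating set of the sibling tree of height \<open>n - 3\<close>. Conversely,
  such a set is extended by the whole level \<open>n - 1\<close> and the left children on level \<open>n\<close>. Hence
  \<open>\<gamma> n = 2 ^ n + \<gamma> (n - 3)\<close>, which is solved by \<open>\<gamma> n = 2 ^ (n + 3) div 7\<close>.\<close>

section \<open>Adjacency in the sibling tree\<close>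

text \<open>The relation carries no height: it is adjacency in the infinite sibling tree, so sets
  for trees of different heights can be compared directly. Positivity is required because
  \<open>1 div 2 = 0\<close> would make 0 a parent of the root.\<close>

definition sib_adj :: "nat \<Rightarrow> nat \<Rightarrow> bool" where
  "sib_adj u v \<longleftrightarrow> 0 < u \<and> 0 < v \<and> u \<noteq> v \<and> (u div 2 = v \<or> v div 2 = u \<or> u div 2 = v div 2)"

abbreviation is_ltds :: "nat \<Rightarrow> nat set \<Rightarrow> bool" where
  "is_ltds n S \<equiv> locating_total_dominating_set (sibling_tree_verts n) (sibling_tree_edges n) S"

lemma sib_adj_sym: "sib_adj u v \<longleftrightarrow> sib_adj v u"
  by (auto simp: sib_adj_def)

lemma sib_adj_iff:
  "sib_adj u v \<longleftrightarrow> (\<exists>x\<ge>1. {u, v} = {x, 2 * x} \<or> {u, v} = {x, 2 * x + 1} \<or> {u, v} = {2 * x, 2 * x + 1})"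
  (is "_ \<longleftrightarrow> ?R")
proof
  assume A: "sib_adj u v"
  consider "v = 2 * u \<or> v = 2 * u + 1" | "u = 2 * v \<or> u = 2 * v + 1"
    | "u = 2 * (u div 2) \<and> v = 2 * (u div 2) + 1" | "v = 2 * (u div 2) \<and> u = 2 * (u div 2) + 1"
    using A unfolding sib_adj_def by linarith
  then show ?R
  proof cases
    case 1 with A show ?thesis by (intro exI[of _ u]) (auto simp: sib_adj_def)
  next
    case 2 with A show ?thesis by (intro exI[of _ v]) (auto simp: sib_adj_def)
  next
    case 3
    moreover have "u div 2 \<ge> 1" using 3 A unfolding sib_adj_def by linarith
    ultimately show ?thesis by (intro exI[of _ "u div 2"]) auto
  next
    case 4
    moreover have "u div 2 \<ge> 1" using 4 A unfolding sib_adj_def by linarith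
    ultimately show ?thesis by (intro exI[of _ "u div 2"]) auto
  qed
qed (auto simp: sib_adj_def doubleton_eq_iff)

text \<open>Every edge of the triangle with top \<open>x\<close> has \<open>2 * x\<close> or
  \<open>2 * x + 1\<close> as an end, so \<open>x < 2 ^ n\<close> amounts to both ends being below
  \<open>2 ^ (n + 1)\<close>. Thus each finite tree is an induced subgraph of the infinite
  one.\<close>

lemma sibling_tree_edges_iff:
  "{u, v} \<in> sibling_tree_edges n \<longleftrightarrow> u < 2 ^ (n + 1) \<and> v < 2 ^ (n + 1) \<and> sib_adj u v"
proof -
  have "{u, v} \<in> sibling_tree_edges n \<longleftrightarrow> (\<exists>x. 1 \<le> x \<and> x < 2 ^ n \<and>
      ({u, v} = {x, 2 * x} \<or> {u, v} = {x, 2 * x + 1} \<or> {u, v} = {2 * x, 2 * x + 1}))"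
    unfolding sibling_tree_edges_def binary_tree_edges_def sibling_edges_def
    by (fastforce simp: image_iff Suc_le_eq less_eq_nat.simps)
  also have "\<dots> \<longleftrightarrow> u < 2 ^ (n + 1) \<and> v < 2 ^ (n + 1) \<and> sib_adj u v"
    unfolding sib_adj_iff by (auto simp: doubleton_eq_iff)
  finally show ?thesis .
qed

text \<open>This and the next two lemmas say that every edge lies in exactly one triangle. Hence a
  vertex outside \<open>S\<close> whose two mates in some triangle are both in \<open>S\<close> is
  separated from all other vertices.\<close>

lemma sib_adj_children_unique:
  assumes "sib_adj (2 * x) v" "sib_adj (2 * x + 1) v"
  shows "v = x"
  using assms unfolding sib_adj_def by (simp; linarith)

lemma sib_adj_parent_left_unique:
  assumes "sib_adj x v" "sib_adj (2 * x) v"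
  shows "v = 2 * x + 1"
  using assms unfolding sib_adj_def by (simp; linarith)

lemma sib_adj_parent_right_unique:
  assumes "sib_adj x v" "sib_adj (2 * x + 1) v"
  shows "v = 2 * x"
  using assms unfolding sib_adj_def by (simp; linarith)

lemma sib_adj_left_cases:
  assumes "sib_adj (2 * x) v"
  shows "v = x \<or> v = 2 * x + 1 \<or> v = 4 * x \<or> v = 4 * x + 1"
  using assms unfolding sib_adj_def by (simp; linarith)

lemma sib_adj_right_cases:
  assumes "sib_adj (2 * x + 1) v"
  shows "v = x \<or> v = 2 * x \<or> v = 4 * x + 2 \<or> v = 4 * x + 3"
  using assms unfolding sib_adj_def by (simp; linarith)

lemma is_ltds_iff:
  "is_ltds n S \<longleftrightarrow> S \<subseteq> {1..<2 ^ (n + 1)} \<and>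
     (\<forall>v\<in>{1..<2 ^ (n + 1)}. \<exists>s\<in>S. sib_adj s v) \<and>
     (\<forall>u\<in>{1..<2 ^ (n + 1)} - S. \<forall>v\<in>{1..<2 ^ (n + 1)} - S. u \<noteq> v \<longrightarrow>
        (\<exists>s\<in>S. sib_adj s u \<noteq> sib_adj s v))"
proof -
  have V: "sibling_tree_verts n = {1..<2 ^ (n + 1)}"
    by (auto simp: sibling_tree_verts_def)
  have dom: "{v, s} \<in> sibling_tree_edges n \<longleftrightarrow> sib_adj s v"
    if "S \<subseteq> {1..<2 ^ (n + 1)}" "s \<in> S" "v \<in> {1..<2 ^ (n + 1)}" for s v
    using that sibling_tree_edges_iff[of v s n] by (auto simp: sib_adj_sym)
  have nb: "open_nbhd (sibling_tree_edges n) v \<inter> S = {s \<in> S. sib_adj s v}"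
    if "S \<subseteq> {1..<2 ^ (n + 1)}" "v \<in> {1..<2 ^ (n + 1)}" for v
    using that sibling_tree_edges_iff[of _ v n] by (auto simp: open_nbhd_def)
  show ?thesis
  proof (cases "S \<subseteq> {1..<2 ^ (n + 1)}")
    case True
    have "(open_nbhd (sibling_tree_edges n) u \<inter> S \<noteq> open_nbhd (sibling_tree_edges n) v \<inter> S)
        \<longleftrightarrow> (\<exists>s\<in>S. sib_adj s u \<noteq> sib_adj s v)"
      if "u \<in> {1..<2 ^ (n + 1)}" "v \<in> {1..<2 ^ (n + 1)}" for u v
      using nb[OF True that(1)] nb[OF True that(2)] by auto
    then have "(\<forall>u\<in>{1..<2 ^ (n + 1)} - S. \<forall>v\<in>{1..<2 ^ (n + 1)} - S. u \<noteq> v \<longrightarrow>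
          open_nbhd (sibling_tree_edges n) u \<inter> S \<noteq> open_nbhd (sibling_tree_edges n) v \<inter> S)
        \<longleftrightarrow> (\<forall>u\<in>{1..<2 ^ (n + 1)} - S. \<forall>v\<in>{1..<2 ^ (n + 1)} - S. u \<noteq> v \<longrightarrow>
          (\<exists>s\<in>S. sib_adj s u \<noteq> sib_adj s v))"
      by (intro ball_cong refl imp_cong) blast
    moreover have "(\<forall>v\<in>{1..<2 ^ (n + 1)}. \<exists>s\<in>S. {v, s} \<in> sibling_tree_edges n)
        \<longleftrightarrow> (\<forall>v\<in>{1..<2 ^ (n + 1)}. \<exists>s\<in>S. sib_adj s v)"
      using dom[OF True] by blast
    ultimately show ?thesis
      using True unfolding locating_total_dominating_set_def total_dominating_set_def V by blast
  next
    case False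
    then show ?thesis
      by (simp add: locating_total_dominating_set_def total_dominating_set_def V)
  qed
qed

section \<open>Counting vertices on the two lowest levels\<close>

lemma sum_card_Int_le:
  assumes "finite I" "finite S" "\<And>i. i \<in> I \<Longrightarrow> B i \<subseteq> A"
    "\<And>i j. i \<in> I \<Longrightarrow> j \<in> I \<Longrightarrow> i \<noteq> j \<Longrightarrow> B i \<inter> B j = {}"
  shows "(\<Sum>i\<in>I. card (S \<inter> B i)) \<le> card (S \<inter> A)"
proof -
  have "(\<Sum>i\<in>I. card (S \<inter> B i)) = card (\<Union>i\<in>I. S \<inter> B i)"
    using assms by (intro card_UN_disjoint[symmetric]) blast+
  also have "\<dots> \<le> card (S \<inter> A)"
    using assms by (intro card_mono) blast+
  finally show ?thesis .
qed

lemma card_ge_2I: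
  assumes "finite A" "a \<in> A" "b \<in> A" "a \<noteq> b"
  shows "2 \<le> card A"
  using card_mono[of A "{a, b}"] assms by simp

lemma is_ltds_finite: "is_ltds n S \<Longrightarrow> finite S"
  unfolding is_ltds_iff using finite_subset by blast

text \<open>The leaves \<open>2 * x\<close> and \<open>2 * x + 1\<close> have no neighbours outside
  the triangle. Separating them forces one of them into \<open>S\<close>, and dominating each forces
  one of its two mates into \<open>S\<close>. So every pair in the triangle meets \<open>S\<close>,
  and at most one of the three vertices is missing.\<close>

lemma is_ltds_bottom_triple:
  assumes S: "is_ltds (Suc m) S" and x: "x \<in> {2 ^ m..<2 ^ (m + 1)}"
  shows "2 \<le> card (S \<inter> {x, 2 * x, 2 * x + 1})"
proof -
  have x0: "x > 0" using x by (metis atLeastLessThan_iff less_le_trans zero_less_power zero_less_numeral)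
  have big: "2 ^ (m + 2) \<le> 4 * x" using x by simp
  have V: "2 * x \<in> {1..<2 ^ (Suc m + 1)}" "2 * x + 1 \<in> {1..<2 ^ (Suc m + 1)}"
    using x x0 by auto
  \<comment> \<open>The children of the two leaves would be numbered from \<open>4 * x\<close> on,
    which is beyond the tree.\<close>
  have not4: "s < 4 * x" if "s \<in> S" for s
  proof -
    have "s < 2 ^ (m + 2)" using S that unfolding is_ltds_iff by auto
    then show ?thesis using big by linarith
  qed
  have l: "s = x \<or> s = 2 * x + 1" if "s \<in> S" "sib_adj s (2 * x)" for s
    using sib_adj_left_cases[of x s] not4[OF that(1)] that(2) by (auto simp: sib_adj_sym)
  have r: "s = x \<or> s = 2 * x" if "s \<in> S" "sib_adj s (2 * x + 1)" for s
    using sib_adj_right_cases[of x s] not4[OF that(1)] that(2) by (auto simp: sib_adj_sym)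
  have "2 * x \<in> S \<or> 2 * x + 1 \<in> S"
  proof (rule ccontr)
    assume A: "\<not> ?thesis"
    then obtain s where "s \<in> S" "sib_adj s (2 * x) \<noteq> sib_adj s (2 * x + 1)"
      using S V unfolding is_ltds_iff by (metis DiffI n_not_Suc_n Suc_eq_plus1)
    moreover have "sib_adj x (2 * x)" "sib_adj x (2 * x + 1)" using x0 by (auto simp: sib_adj_def)
    ultimately show False using l r A by metis
  qed
  moreover have "x \<in> S \<or> 2 * x + 1 \<in> S" "x \<in> S \<or> 2 * x \<in> S"
    using S V l r unfolding is_ltds_iff by blast+
  moreover have "finite (S \<inter> {x, 2 * x, 2 * x + 1})" by simp
  moreover have "x \<noteq> 2 * x" "x \<noteq> 2 * x + 1" "2 * x \<noteq> 2 * x + 1" using x0 by auto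
  ultimately show ?thesis by (meson IntI card_ge_2I insertI1 insertI2)
qed

lemma is_ltds_card_bottom:
  assumes S: "is_ltds (Suc m) S"
  shows "2 ^ Suc m \<le> card (S \<inter> {2 ^ m..})"
proof -
  let ?I = "{2 ^ m..<2 ^ (m + 1)} :: nat set"
  have "2 ^ Suc m = (\<Sum>x\<in>?I. 2 :: nat)" by simp
  also have "\<dots> \<le> (\<Sum>x\<in>?I. card (S \<inter> {x, 2 * x, 2 * x + 1}))"
    using is_ltds_bottom_triple[OF S] by (intro sum_mono)
  also have "\<dots> \<le> card (S \<inter> {2 ^ m..})"
  proof (rule sum_card_Int_le)
    fix x y assume "x \<in> ?I" "y \<in> ?I" "x \<noteq> y"
    moreover from this have "x < 2 * y" "y < 2 * x" by auto
    ultimately show "{x, 2 * x, 2 * x + 1} \<inter> {y, 2 * y, 2 * y + 1} = {}"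
      by auto
  qed (use is_ltds_finite[OF S] in auto)
  finally show ?thesis .
qed

section \<open>Truncating the three lowest levels\<close>

text \<open>If \<open>S\<close> has a single vertex among the children and grandchildren of \<open>w\<close>, then one child of \<open>w\<close>
  can only be dominated by \<open>w\<close> itself.\<close>
lemma is_ltds_local_replacement:
  assumes S: "is_ltds (m + 4) S" and w: "w \<in> {2 ^ m..<2 ^ (m + 1)}"
  shows "\<exists>T \<subseteq> {2 * w, 2 * w + 1}. S \<inter> {2 * w, 2 * w + 1} \<subseteq> T \<and>
    card T \<le> card (S \<inter> ({2 * w, 2 * w + 1} \<union> {4 * w..<4 * w + 4})) \<and>
    (T = {2 * w, 2 * w + 1} \<or> T \<noteq> {} \<and> w \<in> S)"
proof -
  let ?R = "{2 * w, 2 * w + 1}" and ?C = "{4 * w..<4 * w + 4}"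
  have w0: "w > 0" using w by (metis atLeastLessThan_iff less_le_trans zero_less_power zero_less_numeral)
  have fin: "finite (S \<inter> (?R \<union> ?C))" by simp
  have V: "2 * w \<in> {1..<2 ^ (m + 4 + 1)}" "2 * w + 1 \<in> {1..<2 ^ (m + 4 + 1)}"
    using w w0 by (auto simp: power_add)
  have dl: "\<exists>s\<in>S. s = w \<or> s = 2 * w + 1 \<or> s = 4 * w \<or> s = 4 * w + 1"
    using S V sib_adj_left_cases[of w] unfolding is_ltds_iff by (metis sib_adj_sym)
  have dr: "\<exists>s\<in>S. s = w \<or> s = 2 * w \<or> s = 4 * w + 2 \<or> s = 4 * w + 3"
    using S V sib_adj_right_cases[of w] unfolding is_ltds_iff by (metis sib_adj_sym)
  have Ri: "w < 2 * w" "2 * w + 1 < 4 * w" using w0 by auto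
  show ?thesis
  proof (cases "2 \<le> card (S \<inter> (?R \<union> ?C))")
    \<comment> \<open>Two vertices of \<open>S\<close> in the block pay for taking both children of
      \<open>w\<close>.\<close>
    case True
    then show ?thesis by (intro exI[of _ ?R]) auto
  next
    case False
    have one: "a = b" if "a \<in> S \<inter> (?R \<union> ?C)" "b \<in> S \<inter> (?R \<union> ?C)" for a b
      using False card_ge_2I[OF fin that] by blast
    \<comment> \<open>With an empty block both children see at most \<open>w\<close>, so nothing
      separates them.\<close>
    have ex: "S \<inter> (?R \<union> ?C) \<noteq> {}"
    proof
      assume E: "S \<inter> (?R \<union> ?C) = {}"
      have C: "4 * w + i \<notin> S" if "i < 4" for i using E that by auto
      have "2 * w \<notin> S" "2 * w + 1 \<notin> S" using E by auto
      then obtain s where s: "s \<in> S" "sib_adj s (2 * w) \<noteq> sib_adj s (2 * w + 1)"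
        using S V unfolding is_ltds_iff by (metis DiffI n_not_Suc_n Suc_eq_plus1)
      have "sib_adj w (2 * w)" "sib_adj w (2 * w + 1)" using w0 by (auto simp: sib_adj_def)
      then have "s \<noteq> w" using s by auto
      then show False
        using s E C[of 0] C[of 1] C[of 2] C[of 3] sib_adj_left_cases[of w s] sib_adj_right_cases[of w s]
        by (auto simp: sib_adj_sym)
    qed
    \<comment> \<open>Without \<open>w\<close>, the dominators of the two children come from
      disjoint parts of the block, which holds only one vertex of \<open>S\<close>.\<close>
    have "w \<in> S"
    proof (rule ccontr)
      assume "w \<notin> S"
      then obtain s t where "s \<in> S" "s = 2 * w + 1 \<or> s = 4 * w \<or> s = 4 * w + 1"
        "t \<in> S" "t = 2 * w \<or> t = 4 * w + 2 \<or> t = 4 * w + 3" using dl dr by metis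
      moreover from this have "s \<noteq> t" using Ri by auto
      ultimately show False using one[of s t] by auto
    qed
    \<comment> \<open>If the single vertex of the block is a grandchild, it is traded for a child;
      the choice of the left one is arbitrary.\<close>
    define T where "T = (if S \<inter> ?R = {} then {2 * w} else S \<inter> ?R)"
    have "card T \<le> card (S \<inter> (?R \<union> ?C))"
    proof (cases "S \<inter> ?R = {}")
      case True
      then show ?thesis using ex fin by (simp add: T_def Suc_le_eq card_gt_0_iff)
    next
      case False
      then show ?thesis unfolding T_def by (auto intro!: card_mono)
    qed
    then show ?thesis using \<open>w \<in> S\<close> by (intro exI[of _ T]) (auto simp: T_def)
  qed
qed

text \<open>A vertex of the new lowest level outside the new set has both its parent and its sibling
  in that set, which dominates it and separates it from all others. Vertices further up keep their
  old dominators and separators. The vertices of \<open>S\<close> on levels \<open>m + 1\<close> and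
  \<open>m + 2\<close> pay for the new lowest level.\<close>

lemma is_ltds_truncate:
  assumes S: "is_ltds (m + 4) S"
  shows "\<exists>S'. is_ltds (m + 1) S' \<and> card S' \<le> card (S \<inter> {..<2 ^ (m + 3)})"
proof -
  let ?W = "{2 ^ m..<2 ^ (m + 1)} :: nat set"
  let ?D = "\<lambda>w. {2 * w, 2 * w + 1} \<union> {4 * w..<4 * w + 4} :: nat set"
  have fS: "finite S" using is_ltds_finite[OF S] .
  obtain T where T: "\<And>w. w \<in> ?W \<Longrightarrow> T w \<subseteq> {2 * w, 2 * w + 1} \<and> S \<inter> {2 * w, 2 * w + 1} \<subseteq> T w \<and>
      card (T w) \<le> card (S \<inter> ?D w) \<and> (T w = {2 * w, 2 * w + 1} \<or> T w \<noteq> {} \<and> w \<in> S)"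
    using is_ltds_local_replacement[OF S] by metis
  \<comment> \<open>Levels 0 to \<open>m\<close> are kept. The sets \<open>T w\<close> lie on level
    \<open>m + 1\<close> and contain all of \<open>S\<close> there.\<close>
  define S' where "S' = S \<inter> {..<2 ^ (m + 1)} \<union> (\<Union>w\<in>?W. T w)"
  have lev: "\<exists>w\<in>?W. v = 2 * w \<or> v = 2 * w + 1" if "2 ^ (m + 1) \<le> v" "v < 2 ^ (m + 2)" for v :: nat
    using that by (intro bexI[of _ "v div 2"]) auto
  have S0: "S \<subseteq> {1..}" using S unfolding is_ltds_iff by auto
  have sub: "S' \<subseteq> {1..<2 ^ (m + 2)}"
  proof
    fix v assume "v \<in> S'"
    then consider "v \<in> S" "v < 2 ^ (m + 1)" | w where "w \<in> ?W" "v = 2 * w \<or> v = 2 * w + 1"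
      using T unfolding S'_def by blast
    then show "v \<in> {1..<2 ^ (m + 2)}"
    proof cases
      case 1
      then show ?thesis using S0 by auto
    next
      case 2
      moreover have "(1::nat) \<le> 2 ^ m" by simp
      ultimately show ?thesis by auto
    qed
  qed
  have mono: "S \<inter> {..<2 ^ (m + 2)} \<subseteq> S'"
  proof
    fix v assume v: "v \<in> S \<inter> {..<2 ^ (m + 2)}"
    show "v \<in> S'"
    proof (cases "v < 2 ^ (m + 1)")
      case True
      then show ?thesis using v by (auto simp: S'_def)
    next
      case False
      then obtain w where "w \<in> ?W" "v = 2 * w \<or> v = 2 * w + 1" using lev[of v] v
      by (metis IntD2 atLeastLessThan_iff lessThan_iff not_less)
      then show ?thesis using T[of w] v unfolding S'_def by blast
    qed
  qed
  have pair: "2 * w \<in> S' \<and> 2 * w + 1 \<in> S' \<or> (2 * w \<in> S' \<or> 2 * w + 1 \<in> S') \<and> w \<in> S'" if "w \<in> ?W" for w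
  proof -
    have "T w \<subseteq> S'" using that by (auto simp: S'_def)
    moreover have "w \<in> S \<Longrightarrow> w \<in> S'" using that by (auto simp: S'_def)
    ultimately show ?thesis using T[OF that] by blast
  qed
  have W0: "w > 0" if "w \<in> ?W" for w
    using that by (metis atLeastLessThan_iff less_le_trans zero_less_power zero_less_numeral)
  have edges: "sib_adj w (2 * w)" "sib_adj w (2 * w + 1)" "sib_adj (2 * w) (2 * w + 1)" "sib_adj (2 * w + 1) (2 * w)"
    if "w > 0" for w using that by (auto simp: sib_adj_def)
  \<comment> \<open>Neighbours of vertices on levels 0 to \<open>m\<close> reach at most level
    \<open>m + 1\<close>, where \<open>S\<close> is contained in \<open>S'\<close>.\<close>
  have near: "s < 2 ^ (m + 2)" if "sib_adj s v" "v < 2 ^ (m + 1)" for s v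
    using that by (auto simp: sib_adj_def)
  have dom: "\<exists>s\<in>S'. sib_adj s v" if v: "v \<in> {1..<2 ^ (m + 2)}" for v
  proof (cases "v < 2 ^ (m + 1)")
    case True
    have "v \<in> {1..<2 ^ (m + 4 + 1)}" using v by (auto simp: power_add)
    then obtain s where "s \<in> S" "sib_adj s v" using S unfolding is_ltds_iff by blast
    then show ?thesis using mono near[OF _ True] by blast
  next
    case False
    then obtain w where w: "w \<in> ?W" "v = 2 * w \<or> v = 2 * w + 1" using lev[of v] v
      by (metis IntD2 atLeastLessThan_iff lessThan_iff not_less)
    then show ?thesis using pair[OF w(1)] edges[OF W0[OF w(1)]] by metis
  qed
  have loc1: "\<exists>s\<in>S'. sib_adj s u \<noteq> sib_adj s v"
    if u: "u \<notin> S'" "2 ^ (m + 1) \<le> u" "u < 2 ^ (m + 2)" and "u \<noteq> v" for u v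
  proof -
    obtain w where w: "w \<in> ?W" "u = 2 * w \<or> u = 2 * w + 1" using lev[of u] u by blast
    then have "w \<in> S'" "u = 2 * w \<and> 2 * w + 1 \<in> S' \<or> u = 2 * w + 1 \<and> 2 * w \<in> S'"
      using pair[OF w(1)] u by auto
    then show ?thesis
      using edges[OF W0[OF w(1)]] \<open>u \<noteq> v\<close> sib_adj_parent_left_unique[of w v] sib_adj_parent_right_unique[of w v]
      by metis
  qed
  have loc: "\<exists>s\<in>S'. sib_adj s u \<noteq> sib_adj s v"
    if uv: "u \<in> {1..<2 ^ (m + 2)} - S'" "v \<in> {1..<2 ^ (m + 2)} - S'" "u \<noteq> v" for u v
  proof -
    consider "2 ^ (m + 1) \<le> u" | "2 ^ (m + 1) \<le> v" | "u < 2 ^ (m + 1)" "v < 2 ^ (m + 1)" by linarith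
    then show ?thesis
    proof cases
      case 1
      then show ?thesis using loc1[of u v] uv by auto
    next
      case 2
      then show ?thesis using loc1[of v u] uv by auto
    next
      case 3
      have "u \<in> {1..<2 ^ (m + 4 + 1)} - S" "v \<in> {1..<2 ^ (m + 4 + 1)} - S"
        using uv mono by (auto simp: power_add)
      then obtain s where "s \<in> S" "sib_adj s u \<noteq> sib_adj s v"
        using S uv unfolding is_ltds_iff by blast
      then show ?thesis using mono near 3 by blast
    qed
  qed
  have "is_ltds (m + 1) S'" unfolding is_ltds_iff using sub dom loc by simp
  moreover have "card S' \<le> card (S \<inter> {..<2 ^ (m + 3)})"
  proof -
    have "card S' \<le> card (S \<inter> {..<2 ^ (m + 1)}) + card (\<Union>w\<in>?W. T w)"
      unfolding S'_def by (rule card_Un_le)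
    also have "card (\<Union>w\<in>?W. T w) \<le> (\<Sum>w\<in>?W. card (T w))" by (rule card_UN_le) simp
    also have "\<dots> \<le> (\<Sum>w\<in>?W. card (S \<inter> ?D w))" using T by (intro sum_mono) blast
    also have "\<dots> \<le> card (S \<inter> {2 ^ (m + 1)..<2 ^ (m + 3)})"
    proof (rule sum_card_Int_le)
      fix x y assume xy: "x \<in> ?W" "y \<in> ?W" "x \<noteq> y"
      moreover from this have "x < 2 * y" "y < 2 * x" by auto
      \<comment> \<open>An element of the blocks of both \<open>x\<close> and \<open>y\<close>
        would, as \<open>x \<noteq> y\<close>, be a child of one and a grandchild of the other,
        making one index the parent of the other.\<close>
      moreover have "a div 4 = z \<or> a div 2 = z" if "a \<in> ?D z" for a z using that by auto
      moreover have "b div 4 = b div 2 div 2" for b :: nat by simp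
      ultimately show "?D x \<inter> ?D y = {}"
        by auto
    next
      fix x assume "x \<in> ?W"
      then show "?D x \<subseteq> {2 ^ (m + 1)..<2 ^ (m + 3)}" by (auto simp: power_add)
    qed (use fS in auto)
    also have "card (S \<inter> {..<2 ^ (m + 1)}) + card (S \<inter> {2 ^ (m + 1)..<2 ^ (m + 3)})
        = card (S \<inter> {..<2 ^ (m + 1)} \<union> S \<inter> {2 ^ (m + 1)..<2 ^ (m + 3)})"
      using fS by (intro card_Un_disjoint[symmetric]) auto
    also have "\<dots> \<le> card (S \<inter> {..<2 ^ (m + 3)})"
      using fS by (intro card_mono) (auto simp: power_add)
    finally show ?thesis by simp
  qed
  ultimately show ?thesis by blast
qed

section \<open>Lower bound by induction in steps of three\<close>

lemma is_ltds_card_split: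
  assumes "is_ltds (Suc m) S"
  shows "card (S \<inter> {..<2 ^ m}) + 2 ^ Suc m \<le> card S"
proof -
  have "card (S \<inter> {..<2 ^ m}) + card (S \<inter> {2 ^ m..}) = card (S \<inter> {..<2 ^ m} \<union> S \<inter> {2 ^ m..})"
    using is_ltds_finite[OF assms] by (intro card_Un_disjoint[symmetric]) auto
  also have "S \<inter> {..<2 ^ m} \<union> S \<inter> {2 ^ m..} = S" by auto
  finally show ?thesis using is_ltds_card_bottom[OF assms] by simp
qed

text \<open>As 8 = 7 + 1, the closed form satisfies the recurrence for the domination
  number.\<close>

lemma pow2_div7_step: "(2::nat) ^ (n + 3 + 3) div 7 = 2 ^ (n + 3) + 2 ^ (n + 3) div 7"
proof -
  have "(2::nat) ^ (n + 3 + 3) = 7 * 2 ^ (n + 3) + 2 ^ (n + 3)" by (simp add: power_add)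
  then show ?thesis by simp
qed

text \<open>The base cases are 1, 2, 3 and not 0, 1, 2, because the one-vertex tree has no total
  dominating set.\<close>

lemma nat_3_step_induct [consumes 1, case_names 1 2 3 step]:
  assumes "n \<ge> (1::nat)" "P 1" "P 2" "P 3" "\<And>m. P (m + 1) \<Longrightarrow> P (m + 4)"
  shows "P n"
  using assms(1)
proof (induction n rule: less_induct)
  case (less n)
  consider "n = 1" | "n = 2" | "n = 3" | "n \<ge> 4" using less.prems by linarith
  then show ?case
  proof cases
    case 4
    then obtain m where "n = m + 4" using le_Suc_ex by (metis add.commute)
    then show ?thesis using less.IH[of "m + 1"] assms(5) by simp
  qed (use assms in simp_all)
qed

lemma is_ltds_card_ge:
  assumes "n \<ge> 1" "is_ltds n S"
  shows "2 ^ (n + 3) div 7 \<le> card S"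
  using assms
proof (induction n arbitrary: S rule: nat_3_step_induct)
  case 1
  then show ?case using is_ltds_card_split[of 0 S] by simp
next
  case 2
  then have "is_ltds (Suc 1) S" by (simp add: numeral_2_eq_2)
  then show ?case using is_ltds_card_split[of 1 S] by simp
next
  case 3
  then have S: "is_ltds (Suc 2) S" by simp
  \<comment> \<open>The target is \<open>64 div 7 = 9\<close>, one more than the 8 vertices on the
    two lowest levels. The extra vertex is a neighbour of the root, hence 2 or 3.\<close>
  have "1 \<in> {1..<2 ^ (Suc 2 + 1) :: nat}" by simp
  then obtain s where s: "s \<in> S" "sib_adj s 1" using S unfolding is_ltds_iff by blast
  then have "s \<in> S \<inter> {..<2 ^ 2}" by (auto simp: sib_adj_def)
  then have "1 \<le> card (S \<inter> {..<2 ^ 2})" by (metis One_nat_def Suc_leI card_gt_0_iff empty_iff finite_Int finite_lessThan)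
  then show ?case using is_ltds_card_split[OF S] by simp
next
  case (step m)
  obtain S' where S': "is_ltds (m + 1) S'" "card S' \<le> card (S \<inter> {..<2 ^ (m + 3)})"
    using is_ltds_truncate step.prems by blast
  have "m + 4 = Suc (m + 3)" by simp
  then have "card (S \<inter> {..<2 ^ (m + 3)}) + 2 ^ (m + 4) \<le> card S"
    using is_ltds_card_split[of "m + 3" S] step.prems by metis
  moreover have "(2::nat) ^ (m + 4 + 3) div 7 = 2 ^ (m + 4) + 2 ^ (m + 1 + 3) div 7"
    using pow2_div7_step[of "m + 1"] by simp
  ultimately show ?case using step.IH[OF S'(1)] S'(2) by linarith
qed

section \<open>Upper bound by adding three levels\<close>

text \<open>The set \<open>S\<close> may use level \<open>n + 1\<close>: the case \<open>n = 0\<close>, \<open>S = {2}\<close> then yields the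
  set for height 3, although the one-vertex tree has no total dominating set.\<close>
lemma is_ltds_extend:
  fixes n :: nat
  defines "L \<equiv> {2 ^ (n + 2)..<2 ^ (n + 3)}"
  assumes sub: "S \<subseteq> {1..<2 ^ (n + 2)}"
    and dom: "\<And>v. v \<in> {1..<2 ^ (n + 1)} \<Longrightarrow> \<exists>s\<in>S. sib_adj s v"
    and loc: "\<And>u v. u \<in> {1..<2 ^ (n + 1)} - S \<Longrightarrow> v \<in> {1..<2 ^ (n + 1)} - S \<Longrightarrow> u \<noteq> v \<Longrightarrow>
        \<exists>s\<in>S. sib_adj s u \<noteq> sib_adj s v"
  shows "is_ltds (n + 3) (S \<union> L \<union> (*) 2 ` L) \<and> card (S \<union> L \<union> (*) 2 ` L) = card S + 2 ^ (n + 3)"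
proof
  let ?S = "S \<union> L \<union> (*) 2 ` L"
  have pos: "x > 0" if "x \<in> L" for x
    using that unfolding L_def by (metis atLeastLessThan_iff less_le_trans zero_less_power zero_less_numeral)
  have pw: "(2::nat) ^ (n + 2) = 2 * 2 ^ (n + 1)" "(2::nat) ^ (n + 3) = 4 * 2 ^ (n + 1)"
    "(2::nat) ^ (n + 4) = 8 * 2 ^ (n + 1)" by (simp_all add: power_add)
  \<comment> \<open>The four alternatives are levels 0 to \<open>n\<close>, level
    \<open>n + 1\<close>, level \<open>n + 2\<close> (which is \<open>L\<close>), and level
    \<open>n + 3\<close>.\<close>
  have cases: "v < 2 ^ (n + 1) \<or> (0 < v \<and> 2 * v \<in> L \<and> 2 * v + 1 \<in> L) \<or> v \<in> L
      \<or> (\<exists>x\<in>L. v = 2 * x \<or> v = 2 * x + 1)" if "v \<in> {1..<2 ^ (n + 4)}" for v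
  proof (cases "2 ^ (n + 3) \<le> v")
    case True
    then have "v div 2 \<in> L" using that unfolding L_def pw by auto
    moreover have "v = 2 * (v div 2) \<or> v = 2 * (v div 2) + 1" by linarith
    ultimately show ?thesis by blast
  next
    case False
    then show ?thesis using that unfolding L_def pw by auto
  qed
  have dom': "\<exists>s\<in>?S. sib_adj s v" if v: "v \<in> {1..<2 ^ (n + 4)}" for v
    using cases[OF v]
  proof (elim disjE bexE conjE)
    assume "v < 2 ^ (n + 1)"
    then show ?thesis using dom[of v] v by auto
  next
    assume "0 < v" "2 * v \<in> L"
    then show ?thesis by (intro bexI[of _ "2 * v"]) (auto simp: sib_adj_def)
  next
    assume "v \<in> L"
    then show ?thesis using pos[of v] by (intro bexI[of _ "2 * v"]) (auto simp: sib_adj_def)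
  next
    fix x assume "x \<in> L" "v = 2 * x"
    then show ?thesis using pos[of x] by (intro bexI[of _ x]) (auto simp: sib_adj_def)
  next
    fix x assume "x \<in> L" "v = 2 * x + 1"
    then show ?thesis using pos[of x] by (intro bexI[of _ x]) (auto simp: sib_adj_def)
  qed
  have loc1: "\<exists>s\<in>?S. sib_adj s u \<noteq> sib_adj s v"
    if u: "u \<in> {1..<2 ^ (n + 4)} - ?S" "2 ^ (n + 1) \<le> u" and "u \<noteq> v" for u v
  proof -
    \<comment> \<open>A vertex left out below level \<open>n\<close> is either on level
      \<open>n + 1\<close>, with both children in \<open>L\<close>, or a right leaf, with parent and
      sibling in the set. Either way two mates of a triangle identify it.\<close>
    have "(0 < u \<and> 2 * u \<in> L \<and> 2 * u + 1 \<in> L) \<or> (\<exists>x\<in>L. u = 2 * x + 1)"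
      using cases[of u] u by auto
    then show ?thesis
    proof (elim disjE bexE conjE)
      assume *: "0 < u" "2 * u \<in> L" "2 * u + 1 \<in> L"
      then have "sib_adj (2 * u) u" "sib_adj (2 * u + 1) u" by (auto simp: sib_adj_def)
      then show ?thesis using * sib_adj_children_unique[of u v] \<open>u \<noteq> v\<close> by blast
    next
      fix x assume x: "x \<in> L" "u = 2 * x + 1"
      then have "sib_adj x u" "sib_adj (2 * x) u" using pos[of x] by (auto simp: sib_adj_def)
      then show ?thesis using x sib_adj_parent_left_unique[of x v] \<open>u \<noteq> v\<close> by blast
    qed
  qed
  have loc': "\<exists>s\<in>?S. sib_adj s u \<noteq> sib_adj s v"
    if uv: "u \<in> {1..<2 ^ (n + 4)} - ?S" "v \<in> {1..<2 ^ (n + 4)} - ?S" "u \<noteq> v" for u v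
  proof -
    consider "2 ^ (n + 1) \<le> u" | "2 ^ (n + 1) \<le> v" | "u < 2 ^ (n + 1)" "v < 2 ^ (n + 1)" by linarith
    then show ?thesis
    proof cases
      case 1
      then show ?thesis using loc1[of u v] uv by auto
    next
      case 2
      then show ?thesis using loc1[of v u] uv by (metis (no_types))
    next
      case 3
      then show ?thesis using loc[of u v] uv by auto
    qed
  qed
  have "?S \<subseteq> {1..<2 ^ (n + 4)}"
  proof -
    have "S \<subseteq> {1..<2 ^ (n + 4)}" using sub unfolding pw by auto
    moreover have "L \<union> (*) 2 ` L \<subseteq> {1..<2 ^ (n + 4)}"
      using pos unfolding pw L_def by (auto simp: Suc_le_eq)
    ultimately show ?thesis by blast
  qed
  moreover have "n + 3 + 1 = n + 4" by simp
  ultimately show "is_ltds (n + 3) ?S" unfolding is_ltds_iff using dom' loc' by metis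
  have fin: "finite S" "finite L" using sub finite_subset unfolding L_def by blast+
  have "card ?S = card (S \<union> L) + card ((*) 2 ` L)"
    using fin sub by (intro card_Un_disjoint) (auto simp: L_def pw)
  also have "card (S \<union> L) = card S + card L"
    using fin sub by (intro card_Un_disjoint) (auto simp: L_def)
  also have "card ((*) 2 ` L) = card L" by (intro card_image) (auto simp: inj_on_def)
  also have "card L = 2 ^ (n + 2)" by (simp add: L_def power_add)
  finally show "card ?S = card S + 2 ^ (n + 3)" by (simp add: power_add)
qed

lemma is_ltds_exists:
  assumes "n \<ge> 1"
  shows "\<exists>S. is_ltds n S \<and> card S = 2 ^ (n + 3) div 7"
  using assms
proof (induction n rule: nat_3_step_induct)
  case 1
  have "{1..<2 ^ (1 + 1)} = {1, 2, 3 :: nat}" by auto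
  \<comment> \<open>This witness and the one for height 2 follow the pattern of the extension with
    nothing above: all of level \<open>n - 1\<close> and the left children on level
    \<open>n\<close>.\<close>
  then have "is_ltds 1 {1, 2}" unfolding is_ltds_iff by (simp add: sib_adj_def)
  then show ?case by (intro exI[of _ "{1, 2}"]) simp
next
  case 2
  have "{1..<2 ^ (2 + 1)} = {1, 2, 3, 4, 5, 6, 7 :: nat}" by auto
  then have "is_ltds 2 {2, 3, 4, 6}" unfolding is_ltds_iff by (simp add: sib_adj_def insert_Diff_if)
  then show ?case by (intro exI[of _ "{2, 3, 4, 6}"]) simp
next
  case 3
  have one: "v = 1" if "v \<in> {1..<2 ^ (0 + 1)}" for v :: nat using that by auto
  have "sib_adj 2 1" by (simp add: sib_adj_def)
  then show ?case using is_ltds_extend[of "{2}" 0] one by fastforce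
next
  case (step m)
  then obtain S where S: "is_ltds (m + 1) S" "card S = 2 ^ (m + 1 + 3) div 7" by blast
  have "S \<subseteq> {1..<2 ^ (m + 1 + 2)}" using S(1) unfolding is_ltds_iff by fastforce
  then obtain S' where "is_ltds (m + 1 + 3) S'" "card S' = card S + 2 ^ (m + 1 + 3)"
    using is_ltds_extend[of S "m + 1"] S(1) unfolding is_ltds_iff by blast
  then show ?case using S(2) pow2_div7_step[of "m + 1"] by (intro exI[of _ S']) (simp add: add.commute)
qed

section \<open>The closed form and its residues modulo 7\<close>

lemma locating_total_domination_number_sibling_tree:
  assumes "n \<ge> 1"
  shows "locating_total_domination_number (sibling_tree_verts n) (sibling_tree_edges n) = 2 ^ (n + 3) div 7"
  unfolding locating_total_domination_number_def
proof (rule Least_equality)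
  show "\<exists>S. is_ltds n S \<and> finite S \<and> card S = 2 ^ (n + 3) div 7"
    using is_ltds_exists[OF assms] is_ltds_finite by blast
qed (use is_ltds_card_ge[OF assms] in blast)

text \<open>Since 8 is 1 modulo 7, only \<open>n mod 3\<close> matters, and the values 1, 2, 4 are
  already reduced. They are the constants subtracted in the three cases of the theorem.\<close>

lemma pow2_mod7: "(2::nat) ^ n mod 7 = 2 ^ (n mod 3)"
proof -
  have "(2::nat) ^ n = 2 ^ (3 * (n div 3) + n mod 3)" by simp
  also have "\<dots> = 8 ^ (n div 3) * 2 ^ (n mod 3)" unfolding power_add power_mult by simp
  also have "\<dots> mod 7 = (8 mod 7) ^ (n div 3) * 2 ^ (n mod 3) mod 7"
    by (metis mod_mult_left_eq power_mod)
  also have "\<dots> = 2 ^ (n mod 3) mod 7" by simp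
  also have "\<dots> = 2 ^ (n mod 3)"
  proof -
    have "n mod 3 \<in> {0, 1, 2}" by auto
    then show ?thesis by auto
  qed
  finally show ?thesis .
qed

theorem theorem8:
  fixes n :: nat
  assumes "n \<ge> 1"
  defines "\<gamma> \<equiv> locating_total_domination_number (sibling_tree_verts n) (sibling_tree_edges n)"
  shows "(n mod 3 = 0 \<longrightarrow> real \<gamma> = (1 / 7) * (2 ^ (n + 3) - 1)) \<and>
         (n mod 3 = 1 \<longrightarrow> real \<gamma> = (1 / 7) * (2 ^ (n + 3) - 2)) \<and>
         (n mod 3 = 2 \<longrightarrow> real \<gamma> = (1 / 7) * (2 ^ (n + 3) - 4))"
proof -
  \<comment> \<open>Division with remainder by 7, where \<open>n + 3\<close> and \<open>n\<close>
    agree modulo 3. Stated additively, it carries over to the reals without subtraction on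
    naturals.\<close>
  have "2 ^ (n + 3) = 7 * \<gamma> + 2 ^ (n mod 3)"
    unfolding \<gamma>_def locating_total_domination_number_sibling_tree[OF assms(1)]
    using mult_div_mod_eq[of 7 "2 ^ (n + 3) :: nat"] pow2_mod7[of "n + 3"] by simp
  then have "2 ^ (n + 3) = 7 * real \<gamma> + 2 ^ (n mod 3)"
    by (metis of_nat_add of_nat_mult of_nat_numeral of_nat_power)
  then show ?thesis by (auto simp: field_simps)
qed

end
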